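(* Let $q=p^m$ be a power of an odd prime $p$ and let $n\ge 1$ be an integer. If $f:\mathbb{F}_{q^n}^*\to\mathbb{F}_q$ is a difference balanced function, then there exist $b\in\mathbb{F}_q$ and a balanced function $g:\mathbb{F}_{q^n}^*\to\mathbb{F}_q$ such that $f(x)=g(x)+b$ for all $x\in\mathbb{F}_{q^n}^*$.
   Context: A function $h:\mathbb{F}_{q^n}^*\to\mathbb{F}_q$ is balanced if $|\{x\in\mathbb{F}_{q^n}^*: h(x)=0\}|=q^{n-1}-1$ and $|\{x\in\mathbb{F}_{q^n}^*: h(x)=b\}|=q^{n-1}$ for each $b\in\mathbb{F}_q^*$. A function $f:\mathbb{F}_{q^n}^*\to\mathbb{F}_q$ is difference balanced if for each $a\in\mathbb{F}_{q^n}^*\setminus\{1\}$ the function $x\mapsto f(ax)-f(x)$ is balanced. *)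

theory Defs
  imports "HOL-Algebra.Algebra"
begin

text \<open>
  The field with \<open>q ^ n\<close> elements is a field \<open>R\<close>, and the field with \<open>q\<close> elements
  is its subfield \<open>K\<close>. A function from the nonzero elements of \<open>R\<close> to \<open>K\<close> is a HOL function
  constrained only on \<open>carrier R - {\<zero>}\<close>; its values elsewhere are irrelevant.
\<close>

definition balanced :: "('a, 'r) ring_scheme \<Rightarrow> 'a set \<Rightarrow> nat \<Rightarrow> nat \<Rightarrow> ('a \<Rightarrow> 'a) \<Rightarrow> bool" where
  "balanced R K q n h \<longleftrightarrow>
     h \<in> carrier R - {\<zero>\<^bsub>R\<^esub>} \<rightarrow> K \<and>
     card {x \<in> carrier R - {\<zero>\<^bsub>R\<^esub>}. h x = \<zero>\<^bsub>R\<^esub>} = q ^ (n - 1) - 1 \<and>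
     (\<forall>b \<in> K - {\<zero>\<^bsub>R\<^esub>}. card {x \<in> carrier R - {\<zero>\<^bsub>R\<^esub>}. h x = b} = q ^ (n - 1))"

definition difference_balanced ::
    "('a, 'r) ring_scheme \<Rightarrow> 'a set \<Rightarrow> nat \<Rightarrow> nat \<Rightarrow> ('a \<Rightarrow> 'a) \<Rightarrow> bool" where
  "difference_balanced R K q n f \<longleftrightarrow>
     f \<in> carrier R - {\<zero>\<^bsub>R\<^esub>} \<rightarrow> K \<and>
     (\<forall>a \<in> carrier R - {\<zero>\<^bsub>R\<^esub>} - {\<one>\<^bsub>R\<^esub>}.
        balanced R K q n (\<lambda>x. f (a \<otimes>\<^bsub>R\<^esub> x) \<ominus>\<^bsub>R\<^esub> f x))"

end

theory Submission
  imports Defs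
begin

text \<open>
  Let \<open>N b\<close> be the number of nonzero \<open>x\<close> with \<open>f x = b\<close>. Counting the pairs with
  \<open>f (a x) = f x\<close>, first for fixed \<open>x\<close> and then for fixed \<open>a\<close>, determines the sum of the
  \<open>N b ^ 2\<close>. The integers \<open>q ^ (n - 1) - N b\<close> then have sum \<open>1\<close> and sum of squares \<open>1\<close>, so
  they all vanish except one, which equals \<open>1\<close>; the exceptional \<open>b\<close> is the required constant.
\<close>

text \<open>A nonzero integer has square at least 1, so one nonzero value already exhausts the sum
  of squares and leaves nothing for the others. The plain sum then decides between 1 and -1.\<close>

lemma sum_and_sum_squares_eq_1:
  fixes M :: "'a \<Rightarrow> int"
  assumes "finite A" and squares: "(\<Sum>b\<in>A. (M b)\<^sup>2) = 1" and sum: "(\<Sum>b\<in>A. M b) = 1"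
  obtains c where "c \<in> A" "M c = 1" "\<And>b. b \<in> A \<Longrightarrow> b \<noteq> c \<Longrightarrow> M b = 0"
proof -
  obtain c where c: "c \<in> A" "M c \<noteq> 0"
    using sum by (metis sum.neutral zero_neq_one)
  have "(\<Sum>b\<in>A - {c}. (M b)\<^sup>2) = 1 - (M c)\<^sup>2"
    using squares c(1) \<open>finite A\<close> by (simp add: sum.remove)
  moreover have "(M c)\<^sup>2 \<ge> 1"
    using c(2) by (simp add: int_one_le_iff_zero_less)
  moreover have "(\<Sum>b\<in>A - {c}. (M b)\<^sup>2) \<ge> 0"
    by (simp add: sum_nonneg)
  ultimately have "(\<Sum>b\<in>A - {c}. (M b)\<^sup>2) = 0"
    by linarith
  then have zero: "M b = 0" if "b \<in> A" "b \<noteq> c" for b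
    using that \<open>finite A\<close> by (simp add: sum_nonneg_eq_0_iff)
  have "(\<Sum>b\<in>A - {c}. M b) = 0"
    using zero by simp
  then have "M c = 1"
    using sum c(1) \<open>finite A\<close> by (simp add: sum.remove)
  with c(1) show thesis
    using zero by (rule that)
qed

text \<open>Both sides count the pairs \<open>(x, y)\<close> in \<open>A\<close> with
  \<open>f x = f y\<close>: the left by their common value, the right by the first entry.\<close>

lemma sum_card_fibres_squared:
  assumes "finite A" and "finite B" and "f \<in> A \<rightarrow> B"
  shows "(\<Sum>b\<in>B. (card {x \<in> A. f x = b})\<^sup>2) = (\<Sum>x\<in>A. card {y \<in> A. f y = f x})"
proof -
  have "(\<Sum>x\<in>A. card {y \<in> A. f y = f x}) =
      (\<Sum>b\<in>B. \<Sum>x | x \<in> A \<and> f x = b. card {y \<in> A. f y = f x})"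
    using assms by (intro sum.group [symmetric]) auto
  also have "\<dots> = (\<Sum>b\<in>B. (card {x \<in> A. f x = b})\<^sup>2)"
    by (intro sum.cong) (auto simp: power2_eq_square)
  finally show ?thesis ..
qed

text \<open>For fixed nonzero \<open>x\<close>, every nonzero \<open>y\<close> is
  \<open>a \<otimes> x\<close> for exactly one nonzero \<open>a\<close>. Replacing \<open>y\<close>
  by this quotient and exchanging the two summations turns a count over pairs into a count over
  shifts.\<close>

lemma (in field) sum_card_fibres_eq_sum_card_shifts:
  assumes "finite (carrier R)"
  shows "(\<Sum>x\<in>carrier R - {\<zero>}. card {y \<in> carrier R - {\<zero>}. f y = f x}) =
    (\<Sum>a\<in>carrier R - {\<zero>}. card {x \<in> carrier R - {\<zero>}. f (a \<otimes> x) = f x})"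
proof -
  let ?U = "carrier R - {\<zero>}"
  have "card {y \<in> ?U. f y = f x} = card {a \<in> ?U. f (a \<otimes> x) = f x}" if x: "x \<in> ?U" for x
  proof (rule sym, rule bij_betw_same_card [of "\<lambda>a. a \<otimes> x"], rule bij_betwI)
    have inv: "inv x \<in> carrier R" "inv x \<otimes> x = \<one>" "x \<otimes> inv x = \<one>" "inv x \<noteq> \<zero>"
      using x field_Units by auto
    show "(\<lambda>a. a \<otimes> x) \<in> {a \<in> ?U. f (a \<otimes> x) = f x} \<rightarrow> {y \<in> ?U. f y = f x}"
      using x by (auto simp: integral_iff)
    show "(\<lambda>y. y \<otimes> inv x) \<in> {y \<in> ?U. f y = f x} \<rightarrow> {a \<in> ?U. f (a \<otimes> x) = f x}"
      using x inv by (auto simp: integral_iff m_assoc)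
    show "a \<otimes> x \<otimes> inv x = a" if "a \<in> {a \<in> ?U. f (a \<otimes> x) = f x}" for a
      using that x inv by (simp add: m_assoc)
    show "y \<otimes> inv x \<otimes> x = y" if "y \<in> {y \<in> ?U. f y = f x}" for y
      using that x inv by (simp add: m_assoc)
  qed
  then have "(\<Sum>x\<in>?U. card {y \<in> ?U. f y = f x}) = (\<Sum>x\<in>?U. card {a \<in> ?U. f (a \<otimes> x) = f x})"
    by simp
  also have "\<dots> = (\<Sum>a\<in>?U. card {x \<in> ?U. f (a \<otimes> x) = f x})"
    using assms sum.swap_restrict [of ?U ?U "\<lambda>_ _. 1 :: nat" "\<lambda>x a. f (a \<otimes> x) = f x"] by simp
  finally show ?thesis .
qed

lemma (in field) difference_balanced_imp_balanced_shift:
  fixes q n :: nat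
  assumes q: "q > 0" and "n \<ge> 1" and cardR: "card (carrier R) = q ^ n"
    and "subfield K R" and cardK: "card K = q"
    and f: "difference_balanced R K q n f"
  shows "\<exists>b \<in> K. \<exists>g. balanced R K q n g \<and> (\<forall>x \<in> carrier R - {\<zero>}. f x = g x \<oplus> b)"
proof -
  have K: "subring K R"
    using \<open>subfield K R\<close> by (rule subfieldE(1))
  let ?U = "carrier R - {\<zero>}"
  define Q where "Q = q ^ (n - 1)"
  define N where "N b = card {x \<in> ?U. f x = b}" for b
  have Q: "Q > 0" and qQ: "q ^ n = q * Q"
    using q \<open>n \<ge> 1\<close> by (auto simp: Q_def simp flip: power_Suc)
  have finR: "finite (carrier R)" and finK: "finite K"
    using cardR cardK q by (auto intro: card_ge_0_finite)
  have KR: "K \<subseteq> carrier R"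
    using subringE(1) [OF K] .
  have fK: "f \<in> ?U \<rightarrow> K" and bal: "\<And>a. a \<in> ?U - {\<one>} \<Longrightarrow> balanced R K q n (\<lambda>x. f (a \<otimes> x) \<ominus> f x)"
    using f by (auto simp: difference_balanced_def)
  have fR: "f x \<in> carrier R" if "x \<in> ?U" for x
    using fK KR that by blast
  have cardU: "int (card ?U) = int q * int Q - 1"
    using finR cardR qQ q Q by (simp add: card_Diff_singleton of_nat_diff Suc_le_eq)
  \<comment> \<open>The solutions form the zero fibre of a balanced function. That fibre is one
    smaller than the others because 0 is excluded from the domain.\<close>
  have shift: "int (card {x \<in> ?U. f (a \<otimes> x) = f x}) = int Q - 1" if a: "a \<in> ?U - {\<one>}" for a
  proof -
    have "{x \<in> ?U. f (a \<otimes> x) = f x} = {x \<in> ?U. f (a \<otimes> x) \<ominus> f x = \<zero>}"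
    proof (intro Collect_cong conj_cong refl)
      fix x assume x: "x \<in> ?U"
      then have "a \<otimes> x \<in> ?U"
        using a integral by blast
      with x show "f (a \<otimes> x) = f x \<longleftrightarrow> f (a \<otimes> x) \<ominus> f x = \<zero>"
        by (metis fR r_right_minus_eq)
    qed
    then have "card {x \<in> ?U. f (a \<otimes> x) = f x} = Q - 1"
      using bal [OF a] by (simp add: balanced_def Q_def)
    then show ?thesis
      using Q by (simp add: of_nat_diff)
  qed
  have "(\<Sum>b\<in>K. N b) = card ?U"
    unfolding N_def using sum.group [of ?U K f "\<lambda>_. 1 :: nat"] finR finK fK by auto
  then have sumN: "(\<Sum>b\<in>K. int (N b)) = int q * int Q - 1"
    using cardU by (simp flip: of_nat_sum)
  have "(\<Sum>b\<in>K. (N b)\<^sup>2) = (\<Sum>a\<in>?U. card {x \<in> ?U. f (a \<otimes> x) = f x})"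
    unfolding N_def using sum_card_fibres_squared [OF _ finK fK]
      sum_card_fibres_eq_sum_card_shifts [OF finR, of f] finR by simp
  then have "(\<Sum>b\<in>K. (int (N b))\<^sup>2) = (\<Sum>a\<in>?U. int (card {x \<in> ?U. f (a \<otimes> x) = f x}))"
    by (simp flip: of_nat_sum of_nat_power)
  \<comment> \<open>The shift by \<open>\<one>\<close> is the only one that difference balance says
    nothing about; it satisfies the equation at every \<open>x\<close> and so contributes
    \<open>card ?U\<close>.\<close>
  also have "\<dots> = int (card {x \<in> ?U. f (\<one> \<otimes> x) = f x}) +
      (\<Sum>a\<in>?U - {\<one>}. int (card {x \<in> ?U. f (a \<otimes> x) = f x}))"
    using finR by (intro sum.remove) auto
  also have "{x \<in> ?U. f (\<one> \<otimes> x) = f x} = ?U"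
    by auto
  also have "(\<Sum>a\<in>?U - {\<one>}. int (card {x \<in> ?U. f (a \<otimes> x) = f x})) =
      int (card (?U - {\<one>})) * (int Q - 1)"
    using shift by simp
  also have "int (card (?U - {\<one>})) = int q * int Q - 2"
  proof -
    have "card ?U = Suc (card (?U - {\<one>}))"
      using finR by (intro card.remove) auto
    with cardU show ?thesis by linarith
  qed
  finally have sumN2: "(\<Sum>b\<in>K. (int (N b))\<^sup>2) =
      int q * int Q - 1 + (int q * int Q - 2) * (int Q - 1)"
    using cardU by simp
  \<comment> \<open>The deviations are measured from \<open>Q\<close>, the size of a nonzero fibre
    of a balanced function. With both moments of \<open>N\<close> known, everything cancels except
    1.\<close>
  have "(\<Sum>b\<in>K. (int Q - int (N b))\<^sup>2) =
      int q * (int Q)\<^sup>2 - 2 * int Q * (\<Sum>b\<in>K. int (N b)) + (\<Sum>b\<in>K. (int (N b))\<^sup>2)"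
    using cardK
    by (simp add: power2_diff sum.distrib sum_subtractf sum_distrib_left mult.assoc)
  also have "\<dots> = 1"
    unfolding sumN sumN2 by (simp add: algebra_simps power2_eq_square)
  finally have "(\<Sum>b\<in>K. (int Q - int (N b))\<^sup>2) = 1" .
  moreover have "(\<Sum>b\<in>K. int Q - int (N b)) = 1"
    using sumN cardK by (simp add: sum_subtractf)
  ultimately obtain c where c: "c \<in> K" "int Q - int (N c) = 1"
      "\<And>b. b \<in> K \<Longrightarrow> b \<noteq> c \<Longrightarrow> int Q - int (N b) = 0"
    using sum_and_sum_squares_eq_1 [OF finK, of "\<lambda>b. int Q - int (N b)"] by blast
  \<comment> \<open>The fibre sizes are those of a balanced function, except that the short fibre
    lies over \<open>c\<close> instead of \<open>\<zero>\<close>.\<close>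
  have Nc: "N c = Q - 1" and N: "\<And>b. b \<in> K \<Longrightarrow> b \<noteq> c \<Longrightarrow> N b = Q"
    using c(2,3) by auto
  have cR: "c \<in> carrier R"
    using c(1) KR by blast
  \<comment> \<open>Subtracting \<open>c\<close> translates the fibres and moves the short one to
    \<open>\<zero>\<close>.\<close>
  have fibre: "{x \<in> ?U. f x \<ominus> c = b} = {x \<in> ?U. f x = b \<oplus> c}" if "b \<in> K" for b
  proof -
    have "b \<in> carrier R"
      using that KR by blast
    then have "y \<ominus> c = b \<longleftrightarrow> y = b \<oplus> c" if "y \<in> carrier R" for y
      using cR that by (auto simp: a_minus_def a_assoc l_neg r_neg)
    then show ?thesis
      using fR by blast
  qed
  have "balanced R K q n (\<lambda>x. f x \<ominus> c)"
    unfolding balanced_def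
  proof (intro conjI ballI)
    show "(\<lambda>x. f x \<ominus> c) \<in> ?U \<rightarrow> K"
      using fK c(1) subringE(5,7) [OF K] by (fastforce simp: a_minus_def Pi_iff)
    have "\<zero> \<in> K"
      using subringE(2) [OF K] .
    then show "card {x \<in> ?U. f x \<ominus> c = \<zero>} = q ^ (n - 1) - 1"
      using Nc cR fibre [of \<zero>] by (simp add: N_def Q_def)
    fix b assume b: "b \<in> K - {\<zero>}"
    \<comment> \<open>As \<open>b\<close> is nonzero, the translated value avoids the exceptional
      \<open>c\<close>, so its fibre has full size \<open>Q\<close>.\<close>
    then have bc: "b \<oplus> c \<in> K" "b \<oplus> c \<noteq> c"
      using c(1) cR KR subringE(7) [OF K] by auto
    then show "card {x \<in> ?U. f x \<ominus> c = b} = q ^ (n - 1)"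
      using N [OF bc] fibre [of b] b by (simp add: N_def Q_def)
  qed
  moreover have "f x = (f x \<ominus> c) \<oplus> c" if "x \<in> ?U" for x
    using fR [OF that] cR by (simp add: a_minus_def a_assoc l_neg)
  ultimately show ?thesis
    using c(1) by blast
qed

theorem theorem3p1:
  fixes R :: "('a, 'r) ring_scheme" and K :: "'a set"
    and p m q n :: nat and f :: "'a \<Rightarrow> 'a"
  assumes "Factorial_Ring.prime p" and "odd p" and "m \<ge> 1" and "q = p ^ m" and "n \<ge> 1"
    and "field R" and "card (carrier R) = q ^ n"
    and "subfield K R" and "card K = q"
    and "difference_balanced R K q n f"
  shows "\<exists>b \<in> K. \<exists>g. balanced R K q n g \<and>
           (\<forall>x \<in> carrier R - {\<zero>\<^bsub>R\<^esub>}. f x = g x \<oplus>\<^bsub>R\<^esub> b)"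
  using assms by (intro field.difference_balanced_imp_balanced_shift) (auto simp: prime_gt_0_nat)

end
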